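(* Let $\Sigma$ be a discrete projective minimal surface, and consider any associated envelope $\Omega$ whose edges, in either direction, are not shared generators of the lattice Lie quadrics of $\Sigma$. Then $\Sigma$ is a discrete Godeaux-Rozet surface if and only if there exists a line congruence (among $\mathscr L,\mathscr L^1,\mathscr L^2,\mathscr L^{12}$) associated with $\Omega$ which possesses the intersection property in the $n_1$ or $n_2$ direction.
   Context: Discrete asymptotic net: a map $\mathbf r:\mathbb Z^2\to\mathbb R^4$ (homogeneous coordinates of points of $\mathbb P^3$) such that every star (a vertex and its four neighbours) is planar. Subscripts $1,2$ (resp. $\bar 1,\bar 2$) denote unit increments (resp. decrements) of $n_1,n_2$. It is assumed that $\mathbf r,\mathbf r_1,\mathbf r_2,\mathbf r_{12}$ are linearly independent, so that $\mathbf r_{11}=\alpha^0\mathbf r+\alpha^1\mathbf r_1+\alpha^3\mathbf r_{12}$, $\mathbf r_{112}=\beta^1\mathbf r_1+\beta^2\mathbf r_2+\beta^3\mathbf r_{12}$, $\mathbf r_{22}=\gamma^0\mathbf r+\gamma^2\mathbf r_2+\gamma^3\mathbf r_{12}$, $\mathbf r_{122}=\delta^1\mathbf r_1+\delta^2\mathbf r_2+\delta^3\mathbf r_{12}$ (the upper indices are labels; all coefficients are functions on $\mathbb Z^2$), where only $\alpha^1,\beta^3,\gamma^2,\delta^3$ are allowed to vanish. Lattice Lie quadrics: a quadric through the four extended edges of the quadrilateral $[\mathbf r,\mathbf r_1,\mathbf r_2,\mathbf r_{12}]$ is $Q(s,t)=p\,\mathbf r_{12}+s\,\mathbf r_1+t\,\mathbf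 r_2+st\,\mathbf r$, where $p\ne0$ labels the quadric and $s,t$ parametrise its generators. A choice of such a quadric for every quadrilateral (with $p$ a function on $\mathbb Z^2$; the neighbouring quadrics are $Q_1,Q_2$ etc.) is a set of lattice Lie quadrics if the $\mathcal C^1$ condition holds: any two neighbouring quadrics have the same tangent plane at each point of their common edge. Equivalently, $p_1=\alpha^0/(\beta^2p)$ and $p_2=\gamma^0/(\delta^1p)$. A shared generator of two neighbouring quadrics is a line, transversal to (and different from) their common edge, which is a generator of both. Envelope: a lattice $\Omega$ of $\mathbb Z^2$ combinatorics with vertices $\boldsymbol\omega=Q(s,t)\in Q$, one on each quadric, such that the four edges of $\Omega$ emanating from $\boldsymbol\omega$ lie in the tangent plane of $Q$ at $\boldsymbol\omega$. Vertices of envelopes have finite non-zero parameters $s,t$, i.e. do not lie on the extended edges of the corresponding quadrilateral. Homogeneity convention: if a property related to the envelope (such as the edge of $\Omega$ joining $\boldsymbol\omega$ and $\boldsymbol\omega_i$ being a shared generator of $Q$ and $Q_i$, $\boldsymbol\omega$ lying on a generator shared by $Q$ and $Q_i$, or $D^i=0$) holds for one pair of neighbouring quadrics, then it is assumed to hold for all pairs of neighbouring quadrics of the same type (same direction $n_i$). Discriminants: $D^1=(\alpha^0\beta^3-\alpha^1\beta^2p)^2+4\alpha^0\alpha^3\beta^1\beta^2p$, $D^2=(\gamma^0\delta^3-\gamma^2\delta^1p)^2+4\gamma^0\gamma^3\delta^1\delta^2p$. Discrete projective minimal surface: put $T^1=D^1/(\alpha^0\beta^2p)^2$, $T^2=D^2/(\gamma^0\delta^1p)^2$.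 A discrete asymptotic net (with an associated set of lattice Lie quadrics) is discrete projective minimal if $T^1_2-T^1=0$ or, equivalently, $T^2_1-T^2=0$ in a gauge $\mathbf r\to x\mathbf r$ in which $(1-p^2)\frac{\beta^2\delta^1}{\beta^1\delta^2}=1$. Expressed in an arbitrary gauge, this condition is $\bigl(1-\frac{\beta^1\delta^2}{\beta^2\delta^1}\bigr)T^1_2=p^2T^1$ or, equivalently, $\bigl(1-\frac{\beta^1\delta^2}{\beta^2\delta^1}\bigr)T^2_1=p^2T^2$. Discrete Godeaux-Rozet surface: a discrete asymptotic net (with lattice Lie quadrics) with $D^1=0$ (on all of $\mathbb Z^2$) or $D^2=0$ (on all of $\mathbb Z^2$). Line congruences associated with $\Omega$: $\mathscr L,\mathscr L^1,\mathscr L^2,\mathscr L^{12}$ are the $\mathbb Z^2$-families of lines joining the vertex $\boldsymbol\omega\in Q$ to $\mathbf r,\mathbf r_1,\mathbf r_2,\mathbf r_{12}$ respectively, where $[\mathbf r,\mathbf r_1,\mathbf r_2,\mathbf r_{12}]$ is the quadrilateral to which $Q$ belongs. A discrete line congruence $\{l(n_1,n_2)\}$ has the intersection property in the direction $n_i$ if $l\cap l_i\ne\emptyset$ for all $(n_1,n_2)$. *)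

theory Defs
  imports "HOL-Analysis.Analysis"
begin

(* Points, lines and planes of projective 3-space are represented by non-zero vectors,
   two-dimensional subspaces and three-dimensional subspaces of real^4.  The labels n = (n1,n2)
   live in int * int; the subscripts 1, 2, 12 of a lattice function f are the shifts
   f (n + e1), f (n + e2), f (n + e1 + e2). *)

abbreviation e\<^sub>1 :: "int \<times> int" where "e\<^sub>1 \<equiv> (1, 0)"
abbreviation e\<^sub>2 :: "int \<times> int" where "e\<^sub>2 \<equiv> (0, 1)"

type_synonym net = "int \<times> int \<Rightarrow> real ^ 4"
type_synonym scalar = "int \<times> int \<Rightarrow> real"

definition discrete_asymptotic_net :: "net \<Rightarrow> bool" where
  "discrete_asymptotic_net r \<longleftrightarrow>
     (\<forall>n. dim {r n, r (n + e\<^sub>1), r (n - e\<^sub>1), r (n + e\<^sub>2), r (n - e\<^sub>2)} \<le> 3)"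

definition nondegenerate :: "net \<Rightarrow> bool" where
  "nondegenerate r \<longleftrightarrow>
     (\<forall>n. distinct [r n, r (n + e\<^sub>1), r (n + e\<^sub>2), r (n + e\<^sub>1 + e\<^sub>2)] \<and>
          independent {r n, r (n + e\<^sub>1), r (n + e\<^sub>2), r (n + e\<^sub>1 + e\<^sub>2)})"

(* The digits are labels, not exponents. *)
record frame_coeffs =
  \<alpha>0 :: scalar  \<alpha>1 :: scalar  \<alpha>3 :: scalar
  \<beta>1 :: scalar  \<beta>2 :: scalar  \<beta>3 :: scalar
  \<gamma>0 :: scalar  \<gamma>2 :: scalar  \<gamma>3 :: scalar
  \<delta>1 :: scalar  \<delta>2 :: scalar  \<delta>3 :: scalar

definition frame_equations :: "net \<Rightarrow> frame_coeffs \<Rightarrow> bool" where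
  "frame_equations r c \<longleftrightarrow> (\<forall>n.
     r (n + e\<^sub>1 + e\<^sub>1) =
       \<alpha>0 c n *\<^sub>R r n + \<alpha>1 c n *\<^sub>R r (n + e\<^sub>1) + \<alpha>3 c n *\<^sub>R r (n + e\<^sub>1 + e\<^sub>2) \<and>
     r (n + e\<^sub>1 + e\<^sub>1 + e\<^sub>2) =
       \<beta>1 c n *\<^sub>R r (n + e\<^sub>1) + \<beta>2 c n *\<^sub>R r (n + e\<^sub>2) + \<beta>3 c n *\<^sub>R r (n + e\<^sub>1 + e\<^sub>2) \<and>
     r (n + e\<^sub>2 + e\<^sub>2) =
       \<gamma>0 c n *\<^sub>R r n + \<gamma>2 c n *\<^sub>R r (n + e\<^sub>2) + \<gamma>3 c n *\<^sub>R r (n + e\<^sub>1 + e\<^sub>2) \<and>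
     r (n + e\<^sub>1 + e\<^sub>2 + e\<^sub>2) =
       \<delta>1 c n *\<^sub>R r (n + e\<^sub>1) + \<delta>2 c n *\<^sub>R r (n + e\<^sub>2) + \<delta>3 c n *\<^sub>R r (n + e\<^sub>1 + e\<^sub>2))"

definition nonvanishing_coeffs :: "frame_coeffs \<Rightarrow> bool" where
  "nonvanishing_coeffs c \<longleftrightarrow> (\<forall>n.
     \<alpha>0 c n \<noteq> 0 \<and> \<alpha>3 c n \<noteq> 0 \<and> \<beta>1 c n \<noteq> 0 \<and> \<beta>2 c n \<noteq> 0 \<and>
     \<gamma>0 c n \<noteq> 0 \<and> \<gamma>3 c n \<noteq> 0 \<and> \<delta>1 c n \<noteq> 0 \<and> \<delta>2 c n \<noteq> 0)"

(* The quadric p r12 + s r1 + t r2 + s t r with homogeneous generator parameters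
   S = (s0,s1), T = (t0,t1), where s = s1/s0 and t = t1/t0; this covers s = infinity and
   t = infinity.  The affine parameters are recovered by S = (1,s), T = (1,t). *)
definition quadric ::
  "net \<Rightarrow> scalar \<Rightarrow> int \<times> int \<Rightarrow> real \<times> real \<Rightarrow> real \<times> real \<Rightarrow> real ^ 4" where
  "quadric r p n S T =
     (fst S * fst T * p n) *\<^sub>R r (n + e\<^sub>1 + e\<^sub>2) + (snd S * fst T) *\<^sub>R r (n + e\<^sub>1) +
     (fst S * snd T) *\<^sub>R r (n + e\<^sub>2) + (snd S * snd T) *\<^sub>R r n"

(* Span of the four partial derivatives of the bihomogeneous parametrisation, equivalently of
   the two generators through the point. *)
definition tangent_plane ::
  "net \<Rightarrow> scalar \<Rightarrow> int \<times> int \<Rightarrow> real \<times> real \<Rightarrow> real \<times> real \<Rightarrow> (real ^ 4) set" where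
  "tangent_plane r p n S T =
     span {quadric r p n (1, 0) T, quadric r p n (0, 1) T,
           quadric r p n S (1, 0), quadric r p n S (0, 1)}"

definition generator :: "net \<Rightarrow> scalar \<Rightarrow> int \<times> int \<Rightarrow> (real ^ 4) set \<Rightarrow> bool" where
  "generator r p n L \<longleftrightarrow>
     (\<exists>S. S \<noteq> 0 \<and> L = span {quadric r p n S (1, 0), quadric r p n S (0, 1)}) \<or>
     (\<exists>T. T \<noteq> 0 \<and> L = span {quadric r p n (1, 0) T, quadric r p n (0, 1) T})"

(* For e = e1 (e2), the extended edge through r1 (r2) and r12, which lies on both the quadric at n
   and the quadric at n + e. *)
definition common_edge :: "net \<Rightarrow> int \<times> int \<Rightarrow> int \<times> int \<Rightarrow> (real ^ 4) set" where
  "common_edge r n e = span {r (n + e), r (n + e\<^sub>1 + e\<^sub>2)}"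

definition C1_condition :: "net \<Rightarrow> scalar \<Rightarrow> bool" where
  "C1_condition r p \<longleftrightarrow>
     (\<forall>n. \<forall>e \<in> {e\<^sub>1, e\<^sub>2}. \<forall>S T S' T'. S \<noteq> 0 \<longrightarrow> T \<noteq> 0 \<longrightarrow> S' \<noteq> 0 \<longrightarrow> T' \<noteq> 0 \<longrightarrow>
        quadric r p n S T \<in> common_edge r n e \<longrightarrow>
        span {quadric r p n S T} = span {quadric r p (n + e) S' T'} \<longrightarrow>
        tangent_plane r p n S T = tangent_plane r p (n + e) S' T')"

definition lattice_lie_quadrics :: "net \<Rightarrow> scalar \<Rightarrow> bool" where
  "lattice_lie_quadrics r p \<longleftrightarrow> (\<forall>n. p n \<noteq> 0) \<and> C1_condition r p"

definition asymptotic_net_with_lie_quadrics :: "net \<Rightarrow> frame_coeffs \<Rightarrow> scalar \<Rightarrow> bool" where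
  "asymptotic_net_with_lie_quadrics r c p \<longleftrightarrow>
     discrete_asymptotic_net r \<and> nondegenerate r \<and>
     frame_equations r c \<and> nonvanishing_coeffs c \<and> lattice_lie_quadrics r p"

definition D1 :: "frame_coeffs \<Rightarrow> scalar \<Rightarrow> scalar" where
  "D1 c p n = (\<alpha>0 c n * \<beta>3 c n - \<alpha>1 c n * \<beta>2 c n * p n)\<^sup>2
              + 4 * \<alpha>0 c n * \<alpha>3 c n * \<beta>1 c n * \<beta>2 c n * p n"

definition D2 :: "frame_coeffs \<Rightarrow> scalar \<Rightarrow> scalar" where
  "D2 c p n = (\<gamma>0 c n * \<delta>3 c n - \<gamma>2 c n * \<delta>1 c n * p n)\<^sup>2
              + 4 * \<gamma>0 c n * \<gamma>3 c n * \<delta>1 c n * \<delta>2 c n * p n"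

definition T1 :: "frame_coeffs \<Rightarrow> scalar \<Rightarrow> scalar" where
  "T1 c p n = D1 c p n / (\<alpha>0 c n * \<beta>2 c n * p n)\<^sup>2"

definition T2 :: "frame_coeffs \<Rightarrow> scalar \<Rightarrow> scalar" where
  "T2 c p n = D2 c p n / (\<gamma>0 c n * \<delta>1 c n * p n)\<^sup>2"

(* The two alternatives are equivalent forms, in an arbitrary gauge, of one condition. *)
definition discrete_projective_minimal :: "net \<Rightarrow> frame_coeffs \<Rightarrow> scalar \<Rightarrow> bool" where
  "discrete_projective_minimal r c p \<longleftrightarrow>
     asymptotic_net_with_lie_quadrics r c p \<and>
     ((\<forall>n. (1 - \<beta>1 c n * \<delta>2 c n / (\<beta>2 c n * \<delta>1 c n)) * T1 c p (n + e\<^sub>2) = (p n)\<^sup>2 * T1 c p n) \<or>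
      (\<forall>n. (1 - \<beta>1 c n * \<delta>2 c n / (\<beta>2 c n * \<delta>1 c n)) * T2 c p (n + e\<^sub>1) = (p n)\<^sup>2 * T2 c p n))"

definition discrete_godeaux_rozet :: "net \<Rightarrow> frame_coeffs \<Rightarrow> scalar \<Rightarrow> bool" where
  "discrete_godeaux_rozet r c p \<longleftrightarrow>
     asymptotic_net_with_lie_quadrics r c p \<and>
     ((\<forall>n. D1 c p n = 0) \<or> (\<forall>n. D2 c p n = 0))"

definition shared_generator ::
  "net \<Rightarrow> scalar \<Rightarrow> int \<times> int \<Rightarrow> int \<times> int \<Rightarrow> (real ^ 4) set \<Rightarrow> bool" where
  "shared_generator r p n e L \<longleftrightarrow>
     generator r p n L \<and> generator r p (n + e) L \<and>
     L \<noteq> common_edge r n e \<and> L \<inter> common_edge r n e \<noteq> {0}"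

definition vertex :: "net \<Rightarrow> scalar \<Rightarrow> scalar \<Rightarrow> scalar \<Rightarrow> net" where
  "vertex r p s t n = quadric r p n (1, s n) (1, t n)"

definition edge :: "net \<Rightarrow> int \<times> int \<Rightarrow> int \<times> int \<Rightarrow> (real ^ 4) set" where
  "edge \<omega> n e = span {\<omega> n, \<omega> (n + e)}"

(* Neighbouring vertices are required to be distinct points, so that the edges are lines. *)
definition envelope :: "net \<Rightarrow> scalar \<Rightarrow> scalar \<Rightarrow> scalar \<Rightarrow> bool" where
  "envelope r p s t \<longleftrightarrow>
     (\<forall>n. s n \<noteq> 0 \<and> t n \<noteq> 0) \<and>
     (\<forall>n. \<forall>e \<in> {e\<^sub>1, - e\<^sub>1, e\<^sub>2, - e\<^sub>2}.
        span {vertex r p s t n} \<noteq> span {vertex r p s t (n + e)} \<and>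
        edge (vertex r p s t) n e \<subseteq> tangent_plane r p n (1, s n) (1, t n))"

definition all_if_any :: "(int \<times> int \<Rightarrow> bool) \<Rightarrow> bool" where
  "all_if_any P \<longleftrightarrow> ((\<exists>n. P n) \<longrightarrow> (\<forall>n. P n))"

definition homogeneous ::
  "net \<Rightarrow> frame_coeffs \<Rightarrow> scalar \<Rightarrow> scalar \<Rightarrow> scalar \<Rightarrow> bool" where
  "homogeneous r c p s t \<longleftrightarrow>
     (\<forall>e \<in> {e\<^sub>1, e\<^sub>2}.
        all_if_any (\<lambda>n. shared_generator r p n e (edge (vertex r p s t) n e)) \<and>
        all_if_any (\<lambda>n. \<exists>L. shared_generator r p n e L \<and> vertex r p s t n \<in> L)) \<and>
     all_if_any (\<lambda>n. D1 c p n = 0) \<and>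
     all_if_any (\<lambda>n. D2 c p n = 0)"

(* The families of lines joining the vertex on Q to r, r1, r2 and r12, respectively. *)
definition associated_congruences :: "net \<Rightarrow> net \<Rightarrow> (int \<times> int \<Rightarrow> (real ^ 4) set) set" where
  "associated_congruences r \<omega> =
     {\<lambda>n. span {r n, \<omega> n}, \<lambda>n. span {r (n + e\<^sub>1), \<omega> n},
      \<lambda>n. span {r (n + e\<^sub>2), \<omega> n}, \<lambda>n. span {r (n + e\<^sub>1 + e\<^sub>2), \<omega> n}}"

(* Lines meet in projective space iff the subspaces share a non-zero vector. *)
definition intersection_property ::
  "(int \<times> int \<Rightarrow> (real ^ 4) set) \<Rightarrow> int \<times> int \<Rightarrow> bool" where
  "intersection_property l e \<longleftrightarrow> (\<forall>n. \<exists>v. v \<noteq> 0 \<and> v \<in> l n \<and> v \<in> l (n + e))"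

end

(* Express everything at a pair of neighbouring quadrics Q, Q_1 in the frame r, r_1, r_2, r_12.  The
   two tangency conditions for the edge from (s,t) to (s_1,t_1) split: their sum is the bilinear
   relation slope(s) slope(p s_1) = D^1, where slope is the derivative of the quadratic polynomial
   whose zeros are the shared generators, and their difference says that either p s_1 = s, in which
   case the edge is a shared generator, or t (2 t_1 + ...) = 2 alpha^0.  In the second case the four
   4x4 determinants expressing that neighbouring lines of a congruence meet reduce to slope(p s_1)
   for L and L^2, and to slope(s) for L^1 and L^12, so either kind of intersection forces D^1 = 0.
   Conversely D^1 = 0 makes one of the two factors vanish at each site, and it is the same factor
   everywhere because slope(s) = 0 means that the vertex lies on a shared generator, which is
   subject to the homogeneity convention.  Direction n_2 follows by exchanging r_1 with r_2 and s
   with t. *)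

theory Submission
  imports Defs
begin

section \<open>Spans of two and of four vectors\<close>

lemma span_pair: "v \<in> span {a, b} \<longleftrightarrow> (\<exists>x y. v = x *\<^sub>R a + y *\<^sub>R (b::'a::real_vector))"
  unfolding span_insert by (simp add: span_singleton) (metis add.commute diff_add_cancel add_diff_cancel_left')

text \<open>Cramer's rule: as the determinant \<open>x * w - y * z\<close> is non-zero,
  \<open>h\<close> and \<open>k\<close> can be recovered from the two combinations.\<close>

lemma span_pair_eq:
  fixes h k :: "'a::real_vector"
  assumes "x * w \<noteq> y * z"
  shows "span {x *\<^sub>R h + y *\<^sub>R k, z *\<^sub>R h + w *\<^sub>R k} = span {h, k}" (is "span {?f, ?g} = _")
proof
  show "span {?f, ?g} \<subseteq> span {h, k}"
    by (rule span_minimal) (auto simp: span_pair)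
  let ?d = "x * w - y * z"
  have d: "?d \<noteq> 0" using assms by simp
  have "w *\<^sub>R ?f + (- y) *\<^sub>R ?g = ?d *\<^sub>R h" "(- z) *\<^sub>R ?f + x *\<^sub>R ?g = ?d *\<^sub>R k"
    by (simp_all add: algebra_simps)
  then have "h = (1 / ?d) *\<^sub>R (w *\<^sub>R ?f + (- y) *\<^sub>R ?g)" "k = (1 / ?d) *\<^sub>R ((- z) *\<^sub>R ?f + x *\<^sub>R ?g)"
    using d by simp_all
  moreover have "(1 / ?d) *\<^sub>R (x *\<^sub>R ?f + y *\<^sub>R ?g) \<in> span {?f, ?g}" for x y
    by (intro span_scale span_add span_base) auto
  ultimately have "h \<in> span {?f, ?g}" "k \<in> span {?f, ?g}" by metis+
  then show "span {h, k} \<subseteq> span {?f, ?g}"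
    by (intro span_minimal) auto
qed

lemma span_quadruple:
  "v \<in> span {a, b, c, d} \<longleftrightarrow>
    (\<exists>x y z w. v = x *\<^sub>R a + y *\<^sub>R b + z *\<^sub>R c + w *\<^sub>R (d::'a::real_vector))"
  unfolding span_insert[of a] span_insert[of b] mem_Collect_eq span_pair
  by (simp add: algebra_simps)

section \<open>Quadrics attached to four vectors\<close>

text \<open>\<open>u0\<close>, \<open>u1\<close>, \<open>u2\<close>, \<open>u3\<close> stand for r,
  r_1, r_2, r_12. They are arbitrary vectors so that the same formulas apply to the neighbouring
  quadric and, with \<open>u1\<close> and \<open>u2\<close> exchanged, to the direction n_2.\<close>

definition patch :: "real \<Rightarrow> 'a::real_vector \<Rightarrow> 'a \<Rightarrow> 'a \<Rightarrow> 'a \<Rightarrow> real \<times> real \<Rightarrow> real \<times> real \<Rightarrow> 'a" where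
  "patch p u0 u1 u2 u3 S T =
     (fst S * fst T * p) *\<^sub>R u3 + (snd S * fst T) *\<^sub>R u1 + (fst S * snd T) *\<^sub>R u2 + (snd S * snd T) *\<^sub>R u0"

definition patch_tangent ::
  "real \<Rightarrow> 'a::real_vector \<Rightarrow> 'a \<Rightarrow> 'a \<Rightarrow> 'a \<Rightarrow> real \<times> real \<Rightarrow> real \<times> real \<Rightarrow> 'a set" where
  "patch_tangent p u0 u1 u2 u3 S T =
     span {patch p u0 u1 u2 u3 (1, 0) T, patch p u0 u1 u2 u3 (0, 1) T,
           patch p u0 u1 u2 u3 S (1, 0), patch p u0 u1 u2 u3 S (0, 1)}"

definition patch_generator ::
  "real \<Rightarrow> 'a::real_vector \<Rightarrow> 'a \<Rightarrow> 'a \<Rightarrow> 'a \<Rightarrow> 'a set \<Rightarrow> bool" where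
  "patch_generator p u0 u1 u2 u3 L \<longleftrightarrow>
     (\<exists>S. S \<noteq> 0 \<and> L = span {patch p u0 u1 u2 u3 S (1, 0), patch p u0 u1 u2 u3 S (0, 1)}) \<or>
     (\<exists>T. T \<noteq> 0 \<and> L = span {patch p u0 u1 u2 u3 (1, 0) T, patch p u0 u1 u2 u3 (0, 1) T})"

text \<open>The neighbouring quadric is built on r_1, r_11, r_12, r_112, hence the argument order
  \<open>u1 v1 u3 v3\<close>; \<open>span {u1, u3}\<close> is the common edge.\<close>

definition patch_shared ::
  "real \<Rightarrow> real \<Rightarrow> 'a::real_vector \<Rightarrow> 'a \<Rightarrow> 'a \<Rightarrow> 'a \<Rightarrow> 'a \<Rightarrow> 'a \<Rightarrow> 'a set \<Rightarrow> bool" where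
  "patch_shared p q u0 u1 u2 u3 v1 v3 L \<longleftrightarrow>
     patch_generator p u0 u1 u2 u3 L \<and> patch_generator q u1 v1 u3 v3 L \<and>
     L \<noteq> span {u1, u3} \<and> L \<inter> span {u1, u3} \<noteq> {0}"

definition meet :: "'a::real_vector set \<Rightarrow> 'a set \<Rightarrow> bool" where
  "meet l m \<longleftrightarrow> (\<exists>v. v \<noteq> 0 \<and> v \<in> l \<and> v \<in> m)"

text \<open>Exchanging r_1 with r_2 interchanges the two families of generators. This symmetry
  carries the results for n_1 over to n_2.\<close>

lemma patch_swap: "patch p u0 u1 u2 u3 S T = patch p u0 u2 u1 u3 T S"
  by (simp add: patch_def mult.commute add.commute add.left_commute)

lemma patch_tangent_swap: "patch_tangent p u0 u1 u2 u3 S T = patch_tangent p u0 u2 u1 u3 T S"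
  unfolding patch_tangent_def patch_swap[of p u0 u1 u2]
  by (rule arg_cong[where f = span]) auto

lemma patch_generator_swap: "patch_generator p u0 u1 u2 u3 L = patch_generator p u0 u2 u1 u3 L"
  unfolding patch_generator_def patch_swap[of p u0 u1 u2] by (rule disj_commute)

section \<open>Coordinates with respect to a frame\<close>

locale frame =
  fixes u0 u1 u2 u3 :: "'a::real_vector"
  assumes indep: "x0 *\<^sub>R u0 + x1 *\<^sub>R u1 + x2 *\<^sub>R u2 + x3 *\<^sub>R u3 = 0 \<Longrightarrow> x0 = 0 \<and> x1 = 0 \<and> x2 = 0 \<and> x3 = 0"
begin

definition comb :: "real \<Rightarrow> real \<Rightarrow> real \<Rightarrow> real \<Rightarrow> 'a" where
  "comb x0 x1 x2 x3 = x0 *\<^sub>R u0 + x1 *\<^sub>R u1 + x2 *\<^sub>R u2 + x3 *\<^sub>R u3"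

lemma comb_add: "comb x0 x1 x2 x3 + comb y0 y1 y2 y3 = comb (x0 + y0) (x1 + y1) (x2 + y2) (x3 + y3)"
  and comb_scale: "k *\<^sub>R comb x0 x1 x2 x3 = comb (k * x0) (k * x1) (k * x2) (k * x3)"
  and comb_minus: "comb x0 x1 x2 x3 - comb y0 y1 y2 y3 = comb (x0 - y0) (x1 - y1) (x2 - y2) (x3 - y3)"
  by (simp_all add: comb_def algebra_simps)

lemma comb_0: "comb x0 x1 x2 x3 = 0 \<longleftrightarrow> x0 = 0 \<and> x1 = 0 \<and> x2 = 0 \<and> x3 = 0"
  using indep[of x0 x1 x2 x3] by (auto simp: comb_def)

lemma comb_eq: "comb x0 x1 x2 x3 = comb y0 y1 y2 y3 \<longleftrightarrow> x0 = y0 \<and> x1 = y1 \<and> x2 = y2 \<and> x3 = y3"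
proof -
  have "comb x0 x1 x2 x3 = comb y0 y1 y2 y3 \<longleftrightarrow> comb x0 x1 x2 x3 - comb y0 y1 y2 y3 = 0" by simp
  then show ?thesis unfolding comb_minus comb_0 by simp
qed

lemma mem_edge: "v \<in> span {u1, u3} \<longleftrightarrow> (\<exists>x y. v = comb 0 x 0 y)"
  by (simp add: span_pair comb_def)

lemma patch_comb:
  "patch p u0 u1 u2 u3 S T = comb (snd S * snd T) (snd S * fst T) (fst S * snd T) (fst S * fst T * p)"
  by (simp add: patch_def comb_def algebra_simps)

text \<open>In these coordinates the quadric is \<open>x0 * x3 = p * x1 * x2\<close>, and the
  equation describes the polar plane of its point \<open>(s * t, s, t, p)\<close>.\<close>

lemma tangent_equation:
  assumes "comb x0 x1 x2 x3 \<in> patch_tangent p u0 u1 u2 u3 (1, s) (1, t)"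
  shows "p * x0 + s * t * x3 = p * t * x1 + p * s * x2"
  using assms unfolding patch_tangent_def span_quadruple patch_comb comb_add comb_scale comb_eq
  by (auto simp: algebra_simps)

end

section \<open>Two neighbouring quadrics and the C1 condition\<close>

text \<open>\<open>q\<close> is the label of the neighbouring quadric. It is left free here because
  its relation to \<open>p\<close> is derived from tangency in \<open>C1_parameter\<close>.\<close>

locale neighbours = frame +
  fixes a0 a1 a3 b1 b2 b3 p q :: real and v1 v3 :: 'a
  assumes nz: "a0 \<noteq> 0" "a3 \<noteq> 0" "b1 \<noteq> 0" "b2 \<noteq> 0" "p \<noteq> 0"
    and v1: "v1 = a0 *\<^sub>R u0 + a1 *\<^sub>R u1 + a3 *\<^sub>R u3"
    and v3: "v3 = b1 *\<^sub>R u1 + b2 *\<^sub>R u2 + b3 *\<^sub>R u3"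
begin

lemma v_pair_comb:
  "x *\<^sub>R v1 + y *\<^sub>R comb x0 x1 x2 x3 = comb (x * a0 + y * x0) (x * a1 + y * x1) (y * x2) (x * a3 + y * x3)"
  "x *\<^sub>R v3 + y *\<^sub>R comb x0 x1 x2 x3 = comb (y * x0) (x * b1 + y * x1) (x * b2 + y * x2) (x * b3 + y * x3)"
  by (simp_all add: v1 v3 comb_def algebra_simps)

lemma second_comb:
  "x0 *\<^sub>R u1 + x1 *\<^sub>R v1 + x2 *\<^sub>R u3 + x3 *\<^sub>R v3 =
     comb (x1 * a0) (x0 + x1 * a1 + x3 * b1) (x3 * b2) (x1 * a3 + x2 + x3 * b3)"
  by (simp add: v1 v3 comb_def algebra_simps)

text \<open>Only \<open>v1\<close> has a \<open>u0\<close> component and only \<open>v3\<close> has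
  a \<open>u2\<close> component; these are the non-zero numbers \<open>a0\<close> and
  \<open>b2\<close>.\<close>

sublocale second: frame u1 v1 u3 v3
proof
  fix x0 x1 x2 x3
  assume "x0 *\<^sub>R u1 + x1 *\<^sub>R v1 + x2 *\<^sub>R u3 + x3 *\<^sub>R v3 = 0"
  then show "x0 = 0 \<and> x1 = 0 \<and> x2 = 0 \<and> x3 = 0"
    unfolding second_comb comb_0 using nz by auto
qed

lemma second_patch_comb:
  "patch q u1 v1 u3 v3 S T =
     comb (snd S * fst T * a0) (snd S * snd T + snd S * fst T * a1 + fst S * fst T * q * b1)
       (fst S * fst T * q * b2) (snd S * fst T * a3 + fst S * snd T + fst S * fst T * q * b3)"
  unfolding second.patch_comb second.comb_def second_comb by simp

text \<open>Tangency at the single point \<open>u1 + p u3\<close> of the common edge already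
  determines \<open>q\<close>.\<close>

lemma C1_parameter:
  assumes "patch_tangent p u0 u1 u2 u3 (1, 1) (1, 0) = patch_tangent q u1 v1 u3 v3 (p, 1) (0, 1)"
  shows "q * b2 * p = a0"
proof -
  \<comment> \<open>A second point of the generator of the neighbouring quadric that crosses the
    edge there; it must satisfy the tangent equation of the first quadric.\<close>
  have "patch q u1 v1 u3 v3 (p, 1) (1, 0) \<in> patch_tangent q u1 v1 u3 v3 (p, 1) (0, 1)"
    unfolding patch_tangent_def by (rule span_base) simp
  then have "patch q u1 v1 u3 v3 (p, 1) (1, 0) \<in> patch_tangent p u0 u1 u2 u3 (1, 1) (1, 0)"
    using assms by simp
  then have "p * a0 = p * (p * q * b2)"
    unfolding second_patch_comb by (drule_tac tangent_equation) simp
  then show ?thesis using nz by simp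
qed

section \<open>Generators shared by neighbouring quadrics\<close>

definition disc :: real where
  "disc = (a0 * b3 - a1 * b2 * p)\<^sup>2 + 4 * a0 * a3 * b1 * b2 * p"

text \<open>The parameters \<open>s\<close> of shared generators are the zeros of the quadratic polynomial
  \<open>a3 b2 s\<^sup>2 + (a0 b3 - a1 b2 p) s - a0 b1 p\<close>, whose discriminant is \<open>disc\<close> and whose
  derivative is \<open>slope\<close>. Hence \<open>s\<close> is such a zero iff \<open>(slope s)\<^sup>2 = disc\<close>.\<close>

definition slope :: "real \<Rightarrow> real" where
  "slope s = 2 * a3 * b2 * s + (a0 * b3 - a1 * b2 * p)"

abbreviation "\<omega> s t \<equiv> patch p u0 u1 u2 u3 (1, s) (1, t)"
abbreviation "\<omega>' s t \<equiv> patch q u1 v1 u3 v3 (1, s) (1, t)"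

text \<open>A shared generator through the vertex belongs to the transversal family on both
  quadrics. Its parameter is \<open>s\<close> on the first and \<open>s / p\<close> on the second,
  and one further point of it gives the quadratic equation for \<open>s\<close>.\<close>

lemma shared_imp:
  assumes q: "q * b2 * p = a0" and "s \<noteq> 0" "t \<noteq> 0"
    and L: "patch_shared p q u0 u1 u2 u3 v1 v3 L" "\<omega> s t \<in> L"
  shows "(slope s)\<^sup>2 = disc"
proof -
  have ne: "L \<noteq> span {u1, u3}" and meet: "L \<inter> span {u1, u3} \<noteq> {0}"
    and g1: "patch_generator p u0 u1 u2 u3 L" and g2: "patch_generator q u1 v1 u3 v3 L"
    using L(1) by (auto simp: patch_shared_def)
  have "0 \<in> L \<inter> span {u1, u3}"
    using g1 by (auto simp: patch_generator_def span_zero)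
  with meet obtain v where v: "v \<noteq> 0" "v \<in> L" "v \<in> span {u1, u3}" by blast
  from v(3) obtain y z where vv: "v = comb 0 y 0 z"
    unfolding mem_edge by auto
  \<comment> \<open>These two equations cut out the generator with parameter \<open>s\<close>. A
    generator of the other family through the vertex has \<open>T1 \<noteq> 0\<close> and misses the
    common edge.\<close>
  have mem: "x0 = s * x2 \<and> p * x1 = s * x3" if c: "comb x0 x1 x2 x3 \<in> L" for x0 x1 x2 x3
    using g1 unfolding patch_generator_def
  proof (elim disjE exE conjE)
    fix S assume "S \<noteq> 0" and LS: "L = span {patch p u0 u1 u2 u3 S (1, 0), patch p u0 u1 u2 u3 S (0, 1)}"
    obtain S0 S1 where S: "S = (S0, S1)" by (cases S)
    from L(2) obtain x y where "s * t = y * S1" "s = x * S1" "t = y * S0" "1 = x * S0"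
      unfolding LS S patch_comb span_pair comb_add comb_scale comb_eq using nz by auto
    then have "S1 = s * S0" by (metis mult.assoc mult.commute mult_1)
    with c show ?thesis
      unfolding LS S patch_comb span_pair comb_add comb_scale comb_eq by (auto simp: algebra_simps)
  next
    fix T assume "T \<noteq> 0" and LT: "L = span {patch p u0 u1 u2 u3 (1, 0) T, patch p u0 u1 u2 u3 (0, 1) T}"
    obtain T0 T1 where T: "T = (T0, T1)" by (cases T)
    from L(2) have "T1 \<noteq> 0"
      unfolding LT T patch_comb span_pair comb_add comb_scale comb_eq using assms(2,3) by auto
    with v(2) have "v = 0"
      unfolding vv LT T patch_comb span_pair comb_add comb_scale comb_eq comb_0 by auto
    with v(1) show ?thesis by simp
  qed
  \<comment> \<open>The other family on the second quadric is excluded: \<open>mem\<close> forces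
    \<open>T0 = 0\<close>, which is the common edge itself, but \<open>u3\<close> violates
    \<open>mem\<close> because \<open>s\<close> is non-zero.\<close>
  obtain S where S: "S \<noteq> 0" and LS: "L = span {patch q u1 v1 u3 v3 S (1, 0), patch q u1 v1 u3 v3 S (0, 1)}"
    using g2 unfolding patch_generator_def
  proof (elim disjE exE conjE)
    fix T assume "T \<noteq> 0" and LT: "L = span {patch q u1 v1 u3 v3 (1, 0) T, patch q u1 v1 u3 v3 (0, 1) T}"
    obtain T0 T1 where T: "T = (T0, T1)" by (cases T)
    have "patch q u1 v1 u3 v3 (0, 1) T \<in> L" unfolding LT by (rule span_base) simp
    from mem[OF this[unfolded second_patch_comb]] have "T0 = 0" using nz by (simp add: T)
    with T \<open>T \<noteq> 0\<close> have "T1 \<noteq> 0" by (simp add: zero_prod_def)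
    have "patch q u1 v1 u3 v3 (1, 0) T \<in> L" unfolding LT by (rule span_base) simp
    from mem[OF this[unfolded second_patch_comb]] have False
      using \<open>T0 = 0\<close> \<open>T1 \<noteq> 0\<close> \<open>s \<noteq> 0\<close> by (simp add: T)
    then show ?thesis ..
  qed blast
  obtain S0 S1 where S': "S = (S0, S1)" by (cases S)
  \<comment> \<open>The crossing point with the edge fixes the parameter on the second quadric as
    \<open>s / p\<close>.\<close>
  have "patch q u1 v1 u3 v3 S (0, 1) \<in> L" unfolding LS by (rule span_base) simp
  from mem[OF this[unfolded second_patch_comb]] have 1: "p * S1 = s * S0" by (simp add: S')
  with S S' nz have S0: "S0 \<noteq> 0" by (auto simp: zero_prod_def)
  have "patch q u1 v1 u3 v3 S (1, 0) \<in> L" unfolding LS by (rule span_base) simp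
  from mem[OF this[unfolded second_patch_comb]]
  have "p * (S1 * a1 + S0 * q * b1) = s * (S1 * a3 + S0 * q * b3)" by (simp add: S')
  then have "S0 * (s * a1 * p + p * (q * p) * b1) = S0 * (s * s * a3 + s * (q * p) * b3)"
    using 1 by algebra
  then have "s * a1 * p + p * (q * p) * b1 = s * s * a3 + s * (q * p) * b3" using S0 by simp
  then show ?thesis using q unfolding slope_def disc_def by algebra
qed

text \<open>At a zero \<open>s\<close> of the quadratic, the generator \<open>S = (1, s)\<close> of
  the first quadric coincides with \<open>S = (p, s)\<close> of the second. The line is given by its
  points on the edges \<open>u1 u3\<close> and \<open>u0 u2\<close>.\<close>

lemma generator_shared:
  assumes q: "q * b2 * p = a0" and "(slope s)\<^sup>2 = disc"
  shows "patch_shared p q u0 u1 u2 u3 v1 v3 (span {comb 0 s 0 p, comb s 0 1 0})"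
    (is "patch_shared _ _ _ _ _ _ _ _ ?L")
proof -
  \<comment> \<open>Multiplication by \<open>4 * a3 * b2\<close> completes the square.\<close>
  have quad: "b2 * (s * s * a3) + s * a0 * b3 = b2 * s * a1 * p + p * a0 * b1"
  proof -
    have "4 * a3 * b2 * (b2 * (s * s * a3) + s * a0 * b3) = 4 * a3 * b2 * (b2 * s * a1 * p + p * a0 * b1)"
      using assms(2) unfolding slope_def disc_def by algebra
    then show ?thesis using nz by simp
  qed
  have 1: "patch_generator p u0 u1 u2 u3 ?L"
    unfolding patch_generator_def patch_comb
    by (rule disjI1, rule exI[of _ "(1, s)"]) (simp add: zero_prod_def)
  have "comb 0 s 0 p \<in> span {u1, u3}"
    unfolding mem_edge comb_eq by auto
  moreover have "comb 0 s 0 p \<in> ?L" by (rule span_base) simp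
  moreover have "comb 0 s 0 p \<noteq> 0" using nz by (simp add: comb_0)
  ultimately have 2: "?L \<inter> span {u1, u3} \<noteq> {0}" by blast
  have "comb s 0 1 0 \<in> ?L" by (rule span_base) simp
  moreover have "comb s 0 1 0 \<notin> span {u1, u3}"
    unfolding mem_edge comb_eq by auto
  ultimately have 3: "?L \<noteq> span {u1, u3}" by blast
  let ?g = "patch q u1 v1 u3 v3 (p, s) (1, 0)" and ?h = "patch q u1 v1 u3 v3 (p, s) (0, 1)"
  have h: "?h = comb 0 s 0 p" unfolding second_patch_comb by simp
  have g: "?g = ((s * a3 + p * q * b3) / p) *\<^sub>R comb 0 s 0 p + a0 *\<^sub>R comb s 0 1 0"
  proof -
    have "b2 * (p * (s * a1 + p * q * b1)) = b2 * (s * (s * a3 + p * q * b3))"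
      using quad q by algebra
    then have "p * (s * a1 + p * q * b1) = s * (s * a3 + p * q * b3)" using nz by simp
    then show ?thesis
      unfolding second_patch_comb comb_add comb_scale comb_eq using nz q by (simp add: field_simps)
  qed
  have "span {?g, ?h} = ?L"
    using span_pair_eq[of "(s * a3 + p * q * b3) / p" 0 a0 1 "comb 0 s 0 p" "comb s 0 1 0"] nz
    unfolding g h by simp
  then have 4: "patch_generator q u1 v1 u3 v3 ?L"
    unfolding patch_generator_def
    by (intro disjI1 exI[of _ "(p, s)"]) (simp add: zero_prod_def nz)
  show ?thesis unfolding patch_shared_def using 1 2 3 4 by blast
qed

section \<open>Envelope edges in the tangent planes\<close>

lemma envelope_equations:
  assumes q: "q * b2 * p = a0" and t: "t \<noteq> 0"
    and 1: "\<omega>' s' t' \<in> patch_tangent p u0 u1 u2 u3 (1, s) (1, t)"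
    and 2: "\<omega> s t \<in> patch_tangent q u1 v1 u3 v3 (1, s') (1, t')"
  shows "slope s * slope (p * s') = disc"
    and "p * s' = s \<or> 2 * a0 * b2 * p = t * (2 * t' * b2 * p + a0 * b3 + a1 * b2 * p)"
proof -
  have e1: "p * (s' * a0) + s * t * (s' * a3 + t' + q * b3) = p * t * (s' * t' + s' * a1 + q * b1) + p * s * (q * b2)"
    using tangent_equation[OF 1[unfolded second_patch_comb]] by simp
  \<comment> \<open>Coordinates of the vertex in the second frame, solved from
    \<open>second_comb\<close>: the \<open>u0\<close> and \<open>u2\<close> components give
    \<open>y1\<close> and \<open>y3\<close>, and the other two follow.\<close>
  define y1 y3 where "y1 = s * t / a0" and "y3 = t / b2"
  define y0 y2 where "y0 = s - y1 * a1 - y3 * b1" and "y2 = p - y1 * a3 - y3 * b3"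
  have y: "y1 * a0 = s * t" "y3 * b2 = t" using nz by (simp_all add: y1_def y3_def)
  have "\<omega> s t = second.comb y0 y1 y2 y3"
    unfolding second.comb_def second_comb patch_comb comb_eq using y by (simp add: y0_def y2_def)
  with 2 have e2: "q * y0 + s' * t' * y3 = q * t' * y1 + q * s' * y2"
    using second.tangent_equation by simp
  \<comment> \<open>With \<open>q\<close> eliminated through \<open>q * b2 * p = a0\<close>, the
    terms in \<open>a0 - t * t'\<close> have opposite signs in \<open>e1'\<close> and
    \<open>e2''\<close>. They cancel in the sum, while the difference has the factor
    \<open>p * s' - s\<close>.\<close>
  have e1': "(p * s' - s) * (a0 - t * t') * b2 * p + t * (a0 * b3 * s + a3 * b2 * p * s * s' - a0 * b1 * p - a1 * b2 * p * p * s') = 0"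
    using e1 q by algebra
  have e2': "b2 * p * (q * (s - y1 * a1 - y3 * b1) + s' * t' * y3 - q * t' * y1 - q * s' * (p - y1 * a3 - y3 * b3)) = 0"
    using e2 by (simp add: y0_def y2_def)
  have e2'': "(s - p * s') * (a0 - t * t') * b2 * p + t * (s' * a0 * b3 * p + a3 * b2 * p * s * s' - a0 * b1 * p - a1 * b2 * p * s) = 0"
    using e2' q y by algebra
  have "t * (slope s * slope (p * s')) = t * disc"
    using e1' e2'' unfolding slope_def disc_def by algebra
  then show "slope s * slope (p * s') = disc" using t by simp
  have "(p * s' - s) * (2 * a0 * b2 * p - t * (2 * t' * b2 * p + a0 * b3 + a1 * b2 * p)) = 0"
    using e1' e2'' by algebra
  then show "p * s' = s \<or> 2 * a0 * b2 * p = t * (2 * t' * b2 * p + a0 * b3 + a1 * b2 * p)" by simp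
qed

text \<open>Both vertices lie on the generator from \<open>generator_shared\<close> and, being
  distinct points, span it.\<close>

lemma edge_shared:
  assumes q: "q * b2 * p = a0" and s: "p * s' = s" and D: "(slope s)\<^sup>2 = disc"
    and ne: "span {\<omega> s t} \<noteq> span {\<omega>' s' t'}"
  shows "patch_shared p q u0 u1 u2 u3 v1 v3 (span {\<omega> s t, \<omega>' s' t'})"
proof -
  have "4 * a3 * b2 * b2 * p * (p * (s' * a1 + q * b1)) = 4 * a3 * b2 * b2 * p * (s * (s' * a3 + q * b3))"
    using D q s unfolding slope_def disc_def by algebra
  then have e: "p * (s' * a1 + q * b1) = s * (s' * a3 + q * b3)" using nz by simp
  \<comment> \<open>Read off from the \<open>u3\<close> component of the neighbouring vertex, to
    which only \<open>?g\<close> contributes.\<close>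
  define m where "m = (s' * a3 + t' + q * b3) / p"
  have m: "m * p = s' * a3 + t' + q * b3" using nz by (simp add: m_def)
  have "p * (m * s) = p * (s' * t' + s' * a1 + q * b1)" using m e s by algebra
  then have m2: "m * s = s' * t' + s' * a1 + q * b1" using nz by simp
  have m3: "q * b2 * s = s' * a0" unfolding s[symmetric] q[symmetric] by simp
  let ?g = "comb 0 s 0 p" and ?h = "comb s 0 1 0"
  have w: "\<omega> s t = 1 *\<^sub>R ?g + t *\<^sub>R ?h"
    unfolding patch_comb comb_add comb_scale comb_eq by simp
  have w': "\<omega>' s' t' = m *\<^sub>R ?g + (q * b2) *\<^sub>R ?h"
    unfolding second_patch_comb comb_add comb_scale comb_eq using m m2 m3 by simp
  have "1 * (q * b2) \<noteq> t * m"
  proof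
    assume eq: "1 * (q * b2) = t * m"
    then have "m \<noteq> 0" using q nz by auto
    moreover have "\<omega>' s' t' = m *\<^sub>R \<omega> s t"
      unfolding w w' using eq by (simp add: scaleR_add_right mult.commute)
    ultimately show False using ne using span_image_scale[of "{\<omega> s t}" "\<lambda>_. m"] by simp
  qed
  from span_pair_eq[OF this, of ?g ?h]
  have "span {\<omega> s t, \<omega>' s' t'} = span {?g, ?h}" unfolding w w' .
  then show ?thesis using generator_shared[OF q D] by simp
qed

text \<open>This puts a property covered by the homogeneity convention into terms of
  \<open>slope\<close>. For \<open>disc = 0\<close> it becomes \<open>slope s = 0\<close>, which
  thereby spreads from one site to all.\<close>

lemma vertex_on_shared_iff:
  assumes q: "q * b2 * p = a0" and "s \<noteq> 0" "t \<noteq> 0"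
  shows "(\<exists>L. patch_shared p q u0 u1 u2 u3 v1 v3 L \<and> \<omega> s t \<in> L) \<longleftrightarrow> (slope s)\<^sup>2 = disc"
proof
  assume "(slope s)\<^sup>2 = disc"
  then have "patch_shared p q u0 u1 u2 u3 v1 v3 (span {comb 0 s 0 p, comb s 0 1 0})"
    by (rule generator_shared[OF q])
  moreover have "\<omega> s t = 1 *\<^sub>R comb 0 s 0 p + t *\<^sub>R comb s 0 1 0"
    unfolding patch_comb comb_add comb_scale comb_eq by simp
  then have "\<omega> s t \<in> span {comb 0 s 0 p, comb s 0 1 0}"
    unfolding span_pair by blast
  ultimately show "\<exists>L. patch_shared p q u0 u1 u2 u3 v1 v3 L \<and> \<omega> s t \<in> L" by blast
qed (use shared_imp[OF assms] in blast)

section \<open>Intersections of neighbouring lines of the congruences\<close>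

lemma pair_comb:
  "x *\<^sub>R u0 + y *\<^sub>R comb x0 x1 x2 x3 = comb (x + y * x0) (y * x1) (y * x2) (y * x3)"
  "x *\<^sub>R u1 + y *\<^sub>R comb x0 x1 x2 x3 = comb (y * x0) (x + y * x1) (y * x2) (y * x3)"
  "x *\<^sub>R u2 + y *\<^sub>R comb x0 x1 x2 x3 = comb (y * x0) (y * x1) (x + y * x2) (y * x3)"
  "x *\<^sub>R u3 + y *\<^sub>R comb x0 x1 x2 x3 = comb (y * x0) (y * x1) (y * x2) (x + y * x3)"
  by (simp_all add: comb_def algebra_simps)

text \<open>\<open>A\<close> and \<open>B\<close> are the conclusions of
  \<open>envelope_equations\<close> once the alternative \<open>p * s' = s\<close> is
  discarded.\<close>

context
  fixes s t s' t' :: real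
  assumes q: "q * b2 * p = a0" and st: "s \<noteq> 0" "t \<noteq> 0" "s' \<noteq> 0"
    and A: "slope s * slope (p * s') = disc"
    and B: "2 * a0 * b2 * p = t * (2 * t' * b2 * p + a0 * b3 + a1 * b2 * p)"
begin

lemma q_nz: "q \<noteq> 0"
  using q nz by auto

text \<open>The \<open>u2\<close> and \<open>u3\<close> components of a common point give
  \<open>t * (s' * a3 + t' + q * b3) = a0\<close>; comparison with \<open>B\<close> leaves
  \<open>t * slope (p * s') = 0\<close>.\<close>

lemma meet_0: "meet (span {u0, \<omega> s t}) (span {u1, \<omega>' s' t'}) \<longleftrightarrow> slope (p * s') = 0"
proof
  assume "meet (span {u0, \<omega> s t}) (span {u1, \<omega>' s' t'})"
  then obtain v x y z w where v: "v \<noteq> 0" "v = x *\<^sub>R u0 + y *\<^sub>R \<omega> s t" and v': "v = z *\<^sub>R u1 + w *\<^sub>R \<omega>' s' t'"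
    unfolding meet_def span_pair by blast
  from trans[OF v(2)[symmetric] v']
  have e: "x + y * (s * t) = w * (s' * a0)" "y * s = z + w * (s' * t' + s' * a1 + q * b1)"
      "y * t = w * (q * b2)" "y * p = w * (s' * a3 + t' + q * b3)"
    unfolding patch_comb second_patch_comb pair_comb comb_eq by simp_all
  have "w \<noteq> 0"
  proof
    assume "w = 0"
    then have "y = 0" using e(4) nz by simp
    then have "x = 0" using e(1) \<open>w = 0\<close> by simp
    with v \<open>y = 0\<close> show False by simp
  qed
  have "w * (t * slope (p * s')) = w * 0"
    using e(3,4) q B unfolding slope_def by algebra
  then show "slope (p * s') = 0" using st \<open>w \<noteq> 0\<close> by simp
next
  assume "slope (p * s') = 0"
  then have "2 * b2 * p * (t * (s' * a3 + t' + q * b3)) = 2 * b2 * p * a0"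
    using q B unfolding slope_def by algebra
  then have K: "t * (s' * a3 + t' + q * b3) = a0" using nz by simp
  \<comment> \<open>Solution with \<open>w = 1\<close>: the \<open>u2\<close> component determines
    \<open>y\<close>, the \<open>u0\<close> component determines \<open>x\<close>, and
    \<open>K\<close> makes the \<open>u3\<close> component consistent.\<close>
  define y where "y = q * b2 / t"
  define x where "x = s' * a0 - y * (s * t)"
  have y: "y * t = q * b2" using st by (simp add: y_def)
  then have "t * (y * p) = t * (s' * a3 + t' + q * b3)" using K q by algebra
  then have y2: "y * p = s' * a3 + t' + q * b3" using st by simp
  let ?v = "x *\<^sub>R u0 + y *\<^sub>R \<omega> s t"
  have "?v = (y * s - (s' * t' + s' * a1 + q * b1)) *\<^sub>R u1 + 1 *\<^sub>R \<omega>' s' t'"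
    unfolding patch_comb second_patch_comb pair_comb comb_eq using y y2 by (simp add: x_def)
  moreover have "?v \<noteq> 0"
    unfolding patch_comb pair_comb comb_0 using y q_nz nz by auto
  ultimately show "meet (span {u0, \<omega> s t}) (span {u1, \<omega>' s' t'})"
    unfolding meet_def span_pair by blast
qed

text \<open>The \<open>u0\<close> and \<open>u2\<close> components give
  \<open>p * z = w * (s - p * s')\<close>. Inserted into the \<open>u3\<close> component, this puts
  \<open>s\<close> in the place that \<open>p * s'\<close> has in \<open>meet_0\<close>.\<close>

lemma meet_1: "meet (span {u1, \<omega> s t}) (span {v1, \<omega>' s' t'}) \<longleftrightarrow> slope s = 0"
proof
  assume "meet (span {u1, \<omega> s t}) (span {v1, \<omega>' s' t'})"
  then obtain v x y z w where v: "v \<noteq> 0" "v = z *\<^sub>R v1 + w *\<^sub>R \<omega>' s' t'" and v': "v = x *\<^sub>R u1 + y *\<^sub>R \<omega> s t"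
    unfolding meet_def span_pair by blast
  from trans[OF v'[symmetric] v(2)]
  have e: "y * (s * t) = z * a0 + w * (s' * a0)"
      "y * t = w * (q * b2)" "y * p = z * a3 + w * (s' * a3 + t' + q * b3)"
    unfolding patch_comb second_patch_comb pair_comb v_pair_comb comb_eq by simp_all
  have "w \<noteq> 0"
  proof
    assume "w = 0"
    then have "y = 0" using e(2) st by simp
    then have "z = 0" using e(1) \<open>w = 0\<close> nz by simp
    with v \<open>w = 0\<close> show False by simp
  qed
  have "q * b2 * (p * z) = q * b2 * (w * (s - p * s'))" using e(1,2) q by algebra
  then have z: "p * z = w * (s - p * s')" using q_nz nz by simp
  have "w * (t * slope s) = w * 0"
    using e(2,3) z q B unfolding slope_def by algebra
  then show "slope s = 0" using st \<open>w \<noteq> 0\<close> by simp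
next
  assume "slope s = 0"
  then have "2 * b2 * (t * (s * a3 + p * t' + p * q * b3)) = 2 * b2 * (a0 * p)"
    using q B unfolding slope_def by algebra
  then have K: "t * (s * a3 + p * t' + p * q * b3) = a0 * p" using nz by simp
  \<comment> \<open>Again the solution with \<open>w = 1\<close>; \<open>u1\<close> lies on the
    first line, so its coefficient can be adjusted freely.\<close>
  define y z where "y = q * b2 / t" and "z = s / p - s'"
  have y: "y * t = q * b2" and z: "z * p = s - s' * p"
    using st nz by (simp_all add: y_def z_def field_simps)
  have y1: "y * (s * t) = z * a0 + s' * a0" using y z q by algebra
  have "p * t * (y * p) = p * t * (z * a3 + (s' * a3 + t' + q * b3))" using K y z q by algebra
  then have y2: "y * p = z * a3 + (s' * a3 + t' + q * b3)" using st nz by simp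
  let ?v = "(z * a1 + (s' * t' + s' * a1 + q * b1) - y * s) *\<^sub>R u1 + y *\<^sub>R \<omega> s t"
  have "?v = z *\<^sub>R v1 + 1 *\<^sub>R \<omega>' s' t'"
    unfolding patch_comb second_patch_comb pair_comb v_pair_comb comb_eq
    using y y1 y2 by simp
  moreover have "?v \<noteq> 0"
    unfolding patch_comb pair_comb comb_0 using y q_nz nz by auto
  ultimately show "meet (span {u1, \<omega> s t}) (span {v1, \<omega>' s' t'})"
    unfolding meet_def span_pair by blast
qed

text \<open>The components and \<open>B\<close> give
  \<open>2 * a0 * b1 = s' * (a0 * b3 - a1 * b2 * p)\<close>. Substituted into \<open>A\<close>, this
  cancels all terms but a multiple of \<open>s * slope (p * s')\<close>.\<close>

lemma meet_2:
  assumes "meet (span {u2, \<omega> s t}) (span {u3, \<omega>' s' t'})"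
  shows "slope (p * s') = 0"
proof -
  obtain v x y z w where v: "v \<noteq> 0" "v = x *\<^sub>R u2 + y *\<^sub>R \<omega> s t" and v': "v = z *\<^sub>R u3 + w *\<^sub>R \<omega>' s' t'"
    using assms unfolding meet_def span_pair by blast
  from trans[OF v(2)[symmetric] v']
  have e: "y * (s * t) = w * (s' * a0)" "y * s = w * (s' * t' + s' * a1 + q * b1)"
      "x + y * t = w * (q * b2)"
    unfolding patch_comb second_patch_comb pair_comb comb_eq by simp_all
  have "w \<noteq> 0"
  proof
    assume "w = 0"
    then have "y = 0" using e(2) st by simp
    then have "x = 0" using e(3) \<open>w = 0\<close> by simp
    with v \<open>y = 0\<close> show False by simp
  qed
  have "w * (t * (s' * t' + s' * a1 + q * b1)) = w * (s' * a0)" using e(1,2) by algebra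
  then have "t * (s' * t' + s' * a1 + q * b1) = s' * a0" using \<open>w \<noteq> 0\<close> by simp
  then have "t * (2 * a0 * b1) = t * (s' * (a0 * b3 - a1 * b2 * p))" using q B by algebra
  then have "2 * a0 * b1 = s' * (a0 * b3 - a1 * b2 * p)" using st by simp
  then have "2 * a3 * b2 * s * slope (p * s') = 0"
    using A unfolding slope_def disc_def by algebra
  then show ?thesis using st nz by simp
qed

text \<open>As in \<open>meet_2\<close>, but the relation obtained is
  \<open>2 * a0 * b1 * p = s * (a0 * b3 - a1 * b2 * p)\<close>, and \<open>A\<close> leaves a
  multiple of \<open>s' * slope s\<close>.\<close>

lemma meet_3:
  assumes "meet (span {u3, \<omega> s t}) (span {v3, \<omega>' s' t'})"
  shows "slope s = 0"
proof -
  obtain v x y z w where v: "v \<noteq> 0" "v = z *\<^sub>R v3 + w *\<^sub>R \<omega>' s' t'" and v': "v = x *\<^sub>R u3 + y *\<^sub>R \<omega> s t"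
    using assms unfolding meet_def span_pair by blast
  from trans[OF v'[symmetric] v(2)]
  have e: "y * (s * t) = w * (s' * a0)" "y * s = z * b1 + w * (s' * t' + s' * a1 + q * b1)"
      "y * t = z * b2 + w * (q * b2)"
    unfolding patch_comb second_patch_comb pair_comb v_pair_comb comb_eq by simp_all
  have "w \<noteq> 0"
  proof
    assume "w = 0"
    then have "y = 0" using e(1) st by simp
    then have "z = 0" using e(3) \<open>w = 0\<close> nz by simp
    with v \<open>w = 0\<close> show False by simp
  qed
  have z: "s * b2 * z = w * (s' * a0 - s * b2 * q)" using e(1,3) by algebra
  have "w * (t * b1 * (s' * a0 - s * b2 * q) + t * s * b2 * (s' * t' + s' * a1 + q * b1)) = w * (s * b2 * s' * a0)"
    using e(1,2) z by algebra
  then have "t * b1 * (s' * a0 - s * b2 * q) + t * s * b2 * (s' * t' + s' * a1 + q * b1) = s * b2 * s' * a0"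
    using \<open>w \<noteq> 0\<close> by simp
  then have "s' * t * (2 * a0 * b1 * p) = s' * t * (s * (a0 * b3 - a1 * b2 * p))" using q B by algebra
  then have "2 * a0 * b1 * p = s * (a0 * b3 - a1 * b2 * p)" using st by simp
  then have "2 * a3 * b2 * p * s' * slope s = 0"
    using A unfolding slope_def disc_def by algebra
  then show ?thesis using st nz by simp
qed

end

end

section \<open>The equivalence in one lattice direction\<close>

lemma intersection_property_meet: "intersection_property l e \<longleftrightarrow> (\<forall>n. meet (l n) (l (n + e)))"
  by (simp add: intersection_property_def meet_def)

text \<open>The directions \<open>e\<close> and \<open>f\<close> are kept abstract so that one proof
  serves both lattice directions.\<close>

lemma disc_zero_iff_intersection:
  fixes r :: net and p s t :: scalar and e f :: "int \<times> int"
  defines "\<omega> \<equiv> \<lambda>n. patch (p n) (r n) (r (n + e)) (r (n + f)) (r (n + e + f)) (1, s n) (1, t n)"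
  assumes nb: "\<And>n. neighbours (r n) (r (n + e)) (r (n + f)) (r (n + e + f))
      (a0 n) (a1 n) (a3 n) (b1 n) (b2 n) (b3 n) (p n) (r (n + e + e)) (r (n + e + e + f))"
    and q: "\<And>n. p (n + e) * b2 n * p n = a0 n"
    and st: "\<And>n. s n \<noteq> 0" "\<And>n. t n \<noteq> 0"
    and tp: "\<And>n. \<omega> (n + e) \<in> patch_tangent (p n) (r n) (r (n + e)) (r (n + f)) (r (n + e + f)) (1, s n) (1, t n)"
    and tp': "\<And>n. \<omega> n \<in> patch_tangent (p (n + e)) (r (n + e)) (r (n + e + e)) (r (n + e + f)) (r (n + e + e + f))
        (1, s (n + e)) (1, t (n + e))"
    and ne: "\<And>n. span {\<omega> n} \<noteq> span {\<omega> (n + e)}"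
    and hom: "all_if_any (\<lambda>n. \<exists>L. patch_shared (p n) (p (n + e)) (r n) (r (n + e)) (r (n + f)) (r (n + e + f))
        (r (n + e + e)) (r (n + e + e + f)) L \<and> \<omega> n \<in> L)"
    and nsh: "\<And>n. \<not> patch_shared (p n) (p (n + e)) (r n) (r (n + e)) (r (n + f)) (r (n + e + f))
        (r (n + e + e)) (r (n + e + e + f)) (span {\<omega> n, \<omega> (n + e)})"
  shows "(\<forall>n. (a0 n * b3 n - a1 n * b2 n * p n)\<^sup>2 + 4 * a0 n * a3 n * b1 n * b2 n * p n = 0) \<longleftrightarrow>
    (\<exists>l \<in> {\<lambda>n. span {r n, \<omega> n}, \<lambda>n. span {r (n + e), \<omega> n},
      \<lambda>n. span {r (n + f), \<omega> n}, \<lambda>n. span {r (n + e + f), \<omega> n}}. intersection_property l e)"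
    (is "(\<forall>n. ?D n = 0) \<longleftrightarrow> _")
proof -
  define R where "R = (\<lambda>n x. 2 * a3 n * b2 n * x + (a0 n * b3 n - a1 n * b2 n * p n))"
  have shift: "\<omega> (n + e) = patch (p (n + e)) (r (n + e)) (r (n + e + e)) (r (n + e + f)) (r (n + e + e + f))
      (1, s (n + e)) (1, t (n + e))" for n
    unfolding \<omega>_def by (simp add: add.commute add.left_commute add.assoc)
  have facts: "R n (s n) * R n (p n * s (n + e)) = ?D n"
    "meet (span {r n, \<omega> n}) (span {r (n + e), \<omega> (n + e)}) \<longleftrightarrow> R n (p n * s (n + e)) = 0"
    "meet (span {r (n + e), \<omega> n}) (span {r (n + e + e), \<omega> (n + e)}) \<longleftrightarrow> R n (s n) = 0"
    "meet (span {r (n + f), \<omega> n}) (span {r (n + e + f), \<omega> (n + e)}) \<Longrightarrow> R n (p n * s (n + e)) = 0"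
    "meet (span {r (n + e + f), \<omega> n}) (span {r (n + e + e + f), \<omega> (n + e)}) \<Longrightarrow> R n (s n) = 0"
    "(\<exists>L. patch_shared (p n) (p (n + e)) (r n) (r (n + e)) (r (n + f)) (r (n + e + f))
        (r (n + e + e)) (r (n + e + e + f)) L \<and> \<omega> n \<in> L) \<longleftrightarrow> (R n (s n))\<^sup>2 = ?D n" for n
  proof -
    interpret neighbours "r n" "r (n + e)" "r (n + f)" "r (n + e + f)"
      "a0 n" "a1 n" "a3 n" "b1 n" "b2 n" "b3 n" "p n" "p (n + e)" "r (n + e + e)" "r (n + e + e + f)"
      by (rule nb)
    have R: "slope = R n" and D: "disc = ?D n" by (simp_all add: R_def slope_def disc_def fun_eq_iff)
    have vx: "\<omega> n = patch (p n) (r n) (r (n + e)) (r (n + f)) (r (n + e + f)) (1, s n) (1, t n)"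
      by (simp add: \<omega>_def)
    note eqs = envelope_equations[OF q st(2) tp[unfolded shift] tp'[of n, unfolded vx]]
    \<comment> \<open>Equality would turn the product relation into
      \<open>(slope (s n))\<^sup>2 = disc\<close>, making the edge a shared generator against
      \<open>nsh\<close>.\<close>
    have "p n * s (n + e) \<noteq> s n"
    proof
      assume eq: "p n * s (n + e) = s n"
      then have "(slope (s n))\<^sup>2 = disc" using eqs(1) by (simp add: power2_eq_square)
      from edge_shared[OF q eq this] ne[of n] nsh[of n] show False
        unfolding shift unfolding vx by blast
    qed
    with eqs(2) have B: "2 * a0 n * b2 n * p n = t n * (2 * t (n + e) * b2 n * p n + a0 n * b3 n + a1 n * b2 n * p n)"
      by blast
    note hyps = q st(1) st(2) st(1) eqs(1) B
    show "R n (s n) * R n (p n * s (n + e)) = ?D n"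
      using eqs(1) unfolding R D .
    show "meet (span {r n, \<omega> n}) (span {r (n + e), \<omega> (n + e)}) \<longleftrightarrow> R n (p n * s (n + e)) = 0"
      unfolding shift unfolding vx using meet_0[OF hyps] unfolding R .
    show "meet (span {r (n + e), \<omega> n}) (span {r (n + e + e), \<omega> (n + e)}) \<longleftrightarrow> R n (s n) = 0"
      unfolding shift unfolding vx using meet_1[OF hyps] unfolding R .
    show "R n (p n * s (n + e)) = 0"
      if "meet (span {r (n + f), \<omega> n}) (span {r (n + e + f), \<omega> (n + e)})"
      using meet_2[OF hyps that[unfolded shift, unfolded vx]] unfolding R .
    show "R n (s n) = 0"
      if "meet (span {r (n + e + f), \<omega> n}) (span {r (n + e + e + f), \<omega> (n + e)})"
      using meet_3[OF hyps that[unfolded shift, unfolded vx]] unfolding R .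
    show "(\<exists>L. patch_shared (p n) (p (n + e)) (r n) (r (n + e)) (r (n + f)) (r (n + e + f))
        (r (n + e + e)) (r (n + e + e + f)) L \<and> \<omega> n \<in> L) \<longleftrightarrow> (R n (s n))\<^sup>2 = ?D n"
      unfolding vx using vertex_on_shared_iff[OF q st(1) st(2)] unfolding R D .
  qed
  show ?thesis
  proof
    assume D: "\<forall>n. ?D n = 0"
    show "\<exists>l \<in> {\<lambda>n. span {r n, \<omega> n}, \<lambda>n. span {r (n + e), \<omega> n},
      \<lambda>n. span {r (n + f), \<omega> n}, \<lambda>n. span {r (n + e + f), \<omega> n}}. intersection_property l e"
    proof (cases "\<exists>n. R n (s n) = 0")
      \<comment> \<open>One vertex then lies on a shared generator, hence all do by
        \<open>hom\<close>, and the factor \<open>R n (s n)\<close> vanishes at every site.\<close>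
      case True
      moreover have "(R n (s n))\<^sup>2 = ?D n \<longleftrightarrow> R n (s n) = 0" for n
        using D[rule_format, of n] by simp
      ultimately have "R n (s n) = 0" for n
        using hom unfolding all_if_any_def facts(6) by blast
      then have "intersection_property (\<lambda>n. span {r (n + e), \<omega> n}) e"
        unfolding intersection_property_meet facts(3) by blast
      then show ?thesis by blast
    next
      case False
      then have "R n (p n * s (n + e)) = 0" for n
        using facts(1)[of n] D[rule_format, of n] by (metis mult_eq_0_iff)
      then have "intersection_property (\<lambda>n. span {r n, \<omega> n}) e"
        unfolding intersection_property_meet facts(2) by blast
      then show ?thesis by blast
    qed
  next
    assume "\<exists>l \<in> {\<lambda>n. span {r n, \<omega> n}, \<lambda>n. span {r (n + e), \<omega> n},
      \<lambda>n. span {r (n + f), \<omega> n}, \<lambda>n. span {r (n + e + f), \<omega> n}}. intersection_property l e"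
    \<comment> \<open>The first and third congruences force the factor at
      \<open>p n * s (n + e)\<close> to vanish, the second and fourth the factor at
      \<open>s n\<close>.\<close>
    then have "(\<forall>n. R n (s n) = 0) \<or> (\<forall>n. R n (p n * s (n + e)) = 0)"
      unfolding intersection_property_meet
      using facts(2-5) by (auto simp: add_ac)
    then show "\<forall>n. ?D n = 0"
      using facts(1) by (metis mult_zero_left mult_zero_right)
  qed
qed

section \<open>From the net to frames in both directions\<close>

lemma quadric_patch:
  "quadric r p n S T = patch (p n) (r n) (r (n + e\<^sub>1)) (r (n + e\<^sub>2)) (r (n + e\<^sub>1 + e\<^sub>2)) S T"
  by (simp add: quadric_def patch_def)

lemma tangent_plane_patch:
  "tangent_plane r p n S T = patch_tangent (p n) (r n) (r (n + e\<^sub>1)) (r (n + e\<^sub>2)) (r (n + e\<^sub>1 + e\<^sub>2)) S T"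
  by (simp add: tangent_plane_def patch_tangent_def quadric_patch)

lemma generator_patch:
  "generator r p n L = patch_generator (p n) (r n) (r (n + e\<^sub>1)) (r (n + e\<^sub>2)) (r (n + e\<^sub>1 + e\<^sub>2)) L"
  by (simp add: generator_def patch_generator_def quadric_patch)

lemma shift_commute: "n + e\<^sub>2 + e\<^sub>1 = n + e\<^sub>1 + (e\<^sub>2 :: int \<times> int)"
  "n + e\<^sub>2 + e\<^sub>2 + e\<^sub>1 = n + e\<^sub>1 + e\<^sub>2 + (e\<^sub>2 :: int \<times> int)"
  by (simp_all add: add.assoc)

lemma shared_generator_patch_1:
  "shared_generator r p n e\<^sub>1 L \<longleftrightarrow> patch_shared (p n) (p (n + e\<^sub>1)) (r n) (r (n + e\<^sub>1)) (r (n + e\<^sub>2))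
     (r (n + e\<^sub>1 + e\<^sub>2)) (r (n + e\<^sub>1 + e\<^sub>1)) (r (n + e\<^sub>1 + e\<^sub>1 + e\<^sub>2)) L"
  unfolding shared_generator_def patch_shared_def generator_patch common_edge_def ..

lemma shared_generator_patch_2:
  "shared_generator r p n e\<^sub>2 L \<longleftrightarrow> patch_shared (p n) (p (n + e\<^sub>2)) (r n) (r (n + e\<^sub>2)) (r (n + e\<^sub>1))
     (r (n + e\<^sub>2 + e\<^sub>1)) (r (n + e\<^sub>2 + e\<^sub>2)) (r (n + e\<^sub>2 + e\<^sub>2 + e\<^sub>1)) L"
  unfolding shared_generator_def patch_shared_def generator_patch common_edge_def
    patch_generator_swap[of _ "r n" "r (n + e\<^sub>1)"] patch_generator_swap[of _ "r (n + e\<^sub>2)" "r (n + e\<^sub>1 + e\<^sub>2)"]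
    shift_commute ..

text \<open>Distinctness allows the four coefficients to be collected in one function on the
  set.\<close>

lemma independent_quadruple:
  fixes a b c d :: "'a::real_vector"
  assumes "distinct [a, b, c, d]" "independent {a, b, c, d}"
    and "x *\<^sub>R a + y *\<^sub>R b + z *\<^sub>R c + w *\<^sub>R d = 0"
  shows "x = 0 \<and> y = 0 \<and> z = 0 \<and> w = 0"
proof -
  define f where "f = (\<lambda>v. if v = a then x else if v = b then y else if v = c then z else w)"
  have f: "f a = x" "f b = y" "f c = z" "f d = w"
    using assms(1) by (auto simp: f_def)
  have "(\<Sum>v\<in>{a, b, c, d}. f v *\<^sub>R v) = 0"
    using assms(1,3) by (simp add: f add.assoc)
  then have "\<forall>v\<in>{a, b, c, d}. f v = 0"
    using assms(2) by (auto simp: dependent_finite)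
  then show ?thesis using f by auto
qed

lemma neighbours_1:
  assumes "asymptotic_net_with_lie_quadrics r c p"
  shows "neighbours (r n) (r (n + e\<^sub>1)) (r (n + e\<^sub>2)) (r (n + e\<^sub>1 + e\<^sub>2))
      (\<alpha>0 c n) (\<alpha>1 c n) (\<alpha>3 c n) (\<beta>1 c n) (\<beta>2 c n) (\<beta>3 c n) (p n)
      (r (n + e\<^sub>1 + e\<^sub>1)) (r (n + e\<^sub>1 + e\<^sub>1 + e\<^sub>2))"
proof (unfold_locales, goal_cases)
  case (1 x0 x1 x2 x3)
  have "distinct [r n, r (n + e\<^sub>1), r (n + e\<^sub>2), r (n + e\<^sub>1 + e\<^sub>2)]"
    "independent {r n, r (n + e\<^sub>1), r (n + e\<^sub>2), r (n + e\<^sub>1 + e\<^sub>2)}"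
    using assms unfolding asymptotic_net_with_lie_quadrics_def nondegenerate_def by blast+
  from independent_quadruple[OF this 1] show ?case .
qed (use assms in \<open>unfold asymptotic_net_with_lie_quadrics_def frame_equations_def
    nonvanishing_coeffs_def lattice_lie_quadrics_def, blast\<close>)+

text \<open>The frame is now r, r_2, r_1, r_12, so \<open>\<delta>2\<close> takes the place of
  \<open>b1\<close> and \<open>\<delta>1\<close> that of \<open>b2\<close>.\<close>

lemma neighbours_2:
  assumes "asymptotic_net_with_lie_quadrics r c p"
  shows "neighbours (r n) (r (n + e\<^sub>2)) (r (n + e\<^sub>1)) (r (n + e\<^sub>2 + e\<^sub>1))
      (\<gamma>0 c n) (\<gamma>2 c n) (\<gamma>3 c n) (\<delta>2 c n) (\<delta>1 c n) (\<delta>3 c n) (p n)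
      (r (n + e\<^sub>2 + e\<^sub>2)) (r (n + e\<^sub>2 + e\<^sub>2 + e\<^sub>1))"
proof (unfold shift_commute, unfold_locales, goal_cases)
  case (1 x0 x1 x2 x3)
  have "x0 *\<^sub>R r n + x2 *\<^sub>R r (n + e\<^sub>1) + x1 *\<^sub>R r (n + e\<^sub>2) + x3 *\<^sub>R r (n + e\<^sub>1 + e\<^sub>2) = 0"
    using 1 by (simp only: add.assoc add.left_commute)
  from frame.indep[OF neighbours.axioms(1)[OF neighbours_1[OF assms]] this] show ?case by blast
next
  case 8
  have "r (n + e\<^sub>1 + e\<^sub>2 + e\<^sub>2) = \<delta>1 c n *\<^sub>R r (n + e\<^sub>1) + \<delta>2 c n *\<^sub>R r (n + e\<^sub>2) + \<delta>3 c n *\<^sub>R r (n + e\<^sub>1 + e\<^sub>2)"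
    using assms unfolding asymptotic_net_with_lie_quadrics_def frame_equations_def by blast
  then show ?case by (simp only: add.commute[of "\<delta>1 c n *\<^sub>R _"])
qed (use assms in \<open>unfold asymptotic_net_with_lie_quadrics_def frame_equations_def
    nonvanishing_coeffs_def lattice_lie_quadrics_def, blast\<close>)+

lemma C1_parameter_1:
  assumes net: "asymptotic_net_with_lie_quadrics r c p"
  shows "p (n + e\<^sub>1) * \<beta>2 c n * p n = \<alpha>0 c n"
proof (rule neighbours.C1_parameter[OF neighbours_1[OF net]])
  \<comment> \<open>The point r_1 + p r_12 in the parameters of both quadrics: t = 0 on the first, t
    = infinity on the second.\<close>
  have eq: "quadric r p n (1, 1) (1, 0) = quadric r p (n + e\<^sub>1) (p n, 1) (0, 1)"
    by (simp add: quadric_def add_ac)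
  have "quadric r p n (1, 1) (1, 0) = 1 *\<^sub>R r (n + e\<^sub>1) + p n *\<^sub>R r (n + e\<^sub>1 + e\<^sub>2)"
    by (simp add: quadric_def)
  then have "quadric r p n (1, 1) (1, 0) \<in> common_edge r n e\<^sub>1"
    unfolding common_edge_def span_pair by blast
  moreover have "C1_condition r p"
    using net by (simp add: asymptotic_net_with_lie_quadrics_def lattice_lie_quadrics_def)
  ultimately have "tangent_plane r p n (1, 1) (1, 0) = tangent_plane r p (n + e\<^sub>1) (p n, 1) (0, 1)"
    unfolding C1_condition_def
    by (elim allE[of _ n] ballE[of _ _ e\<^sub>1] allE[of _ "(1, 1)"] allE[of _ "(1, 0)"] allE[of _ "(p n, 1)"] allE[of _ "(0, 1)"])
      (simp_all add: eq zero_prod_def)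
  then show "patch_tangent (p n) (r n) (r (n + e\<^sub>1)) (r (n + e\<^sub>2)) (r (n + e\<^sub>1 + e\<^sub>2)) (1, 1) (1, 0) =
    patch_tangent (p (n + e\<^sub>1)) (r (n + e\<^sub>1)) (r (n + e\<^sub>1 + e\<^sub>1)) (r (n + e\<^sub>1 + e\<^sub>2)) (r (n + e\<^sub>1 + e\<^sub>1 + e\<^sub>2)) (p n, 1) (0, 1)"
    unfolding tangent_plane_patch .
qed

lemma C1_parameter_2:
  assumes net: "asymptotic_net_with_lie_quadrics r c p"
  shows "p (n + e\<^sub>2) * \<delta>1 c n * p n = \<gamma>0 c n"
proof (rule neighbours.C1_parameter[OF neighbours_2[OF net]])
  have eq: "quadric r p n (1, 0) (1, 1) = quadric r p (n + e\<^sub>2) (0, 1) (p n, 1)"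
    by (simp add: quadric_def add_ac)
  have "quadric r p n (1, 0) (1, 1) = 1 *\<^sub>R r (n + e\<^sub>2) + p n *\<^sub>R r (n + e\<^sub>1 + e\<^sub>2)"
    by (simp add: quadric_def)
  then have "quadric r p n (1, 0) (1, 1) \<in> common_edge r n e\<^sub>2"
    unfolding common_edge_def span_pair by blast
  moreover have "C1_condition r p"
    using net by (simp add: asymptotic_net_with_lie_quadrics_def lattice_lie_quadrics_def)
  ultimately have "tangent_plane r p n (1, 0) (1, 1) = tangent_plane r p (n + e\<^sub>2) (0, 1) (p n, 1)"
    unfolding C1_condition_def
    by (elim allE[of _ n] ballE[of _ _ e\<^sub>2] allE[of _ "(1, 0)"] allE[of _ "(1, 1)"] allE[of _ "(0, 1)"] allE[of _ "(p n, 1)"])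
      (simp_all add: eq zero_prod_def)
  then show "patch_tangent (p n) (r n) (r (n + e\<^sub>2)) (r (n + e\<^sub>1)) (r (n + e\<^sub>2 + e\<^sub>1)) (1, 1) (1, 0) =
    patch_tangent (p (n + e\<^sub>2)) (r (n + e\<^sub>2)) (r (n + e\<^sub>2 + e\<^sub>2)) (r (n + e\<^sub>2 + e\<^sub>1)) (r (n + e\<^sub>2 + e\<^sub>2 + e\<^sub>1)) (p n, 1) (0, 1)"
    unfolding tangent_plane_patch patch_tangent_swap[of _ "r n" "r (n + e\<^sub>1)"]
      patch_tangent_swap[of _ "r (n + e\<^sub>2)" "r (n + e\<^sub>1 + e\<^sub>2)"] shift_commute .
qed

theorem corollary9p4:
  fixes r :: net and c :: frame_coeffs and p s t :: scalar
  assumes "discrete_projective_minimal r c p"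
    and "envelope r p s t"
    and "homogeneous r c p s t"
    and "\<forall>n. \<forall>e \<in> {e\<^sub>1, e\<^sub>2}. \<not> shared_generator r p n e (edge (vertex r p s t) n e)"
  shows "discrete_godeaux_rozet r c p \<longleftrightarrow>
    (\<exists>l \<in> associated_congruences r (vertex r p s t). \<exists>e \<in> {e\<^sub>1, e\<^sub>2}. intersection_property l e)"
proof -
  have net: "asymptotic_net_with_lie_quadrics r c p"
    using assms(1) by (simp add: discrete_projective_minimal_def)
  let ?\<omega> = "vertex r p s t"
  have st: "\<And>n. s n \<noteq> 0" "\<And>n. t n \<noteq> 0"
    and ne: "\<And>n. span {?\<omega> n} \<noteq> span {?\<omega> (n + e\<^sub>1)}" "\<And>n. span {?\<omega> n} \<noteq> span {?\<omega> (n + e\<^sub>2)}"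
    and edges: "\<And>n e. e \<in> {e\<^sub>1, - e\<^sub>1, e\<^sub>2, - e\<^sub>2} \<Longrightarrow> edge ?\<omega> n e \<subseteq> tangent_plane r p n (1, s n) (1, t n)"
    using assms(2) unfolding envelope_def by blast+
  have step: "?\<omega> (n + e) \<in> tangent_plane r p n (1, s n) (1, t n)"
    if "e \<in> {e\<^sub>1, - e\<^sub>1, e\<^sub>2, - e\<^sub>2}" for n e
    using edges[OF that] unfolding edge_def by (meson insertCI span_base subsetD)
  \<comment> \<open>The last two facts come from the edges in the negative directions, leading from
    the neighbour back to \<open>n\<close>.\<close>
  have tp: "?\<omega> (n + e\<^sub>1) \<in> tangent_plane r p n (1, s n) (1, t n)"
      "?\<omega> (n + e\<^sub>2) \<in> tangent_plane r p n (1, s n) (1, t n)"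
      "?\<omega> n \<in> tangent_plane r p (n + e\<^sub>1) (1, s (n + e\<^sub>1)) (1, t (n + e\<^sub>1))"
      "?\<omega> n \<in> tangent_plane r p (n + e\<^sub>2) (1, s (n + e\<^sub>2)) (1, t (n + e\<^sub>2))" for n
    using step[of e\<^sub>1 n] step[of e\<^sub>2 n] step[of "- e\<^sub>1" "n + e\<^sub>1"] step[of "- e\<^sub>2" "n + e\<^sub>2"]
    by (simp_all add: add.assoc flip: zero_prod_def)
  have v1: "patch (p n) (r n) (r (n + e\<^sub>1)) (r (n + e\<^sub>2)) (r (n + e\<^sub>1 + e\<^sub>2)) (1, s n) (1, t n) = ?\<omega> n"
    and v2: "patch (p n) (r n) (r (n + e\<^sub>2)) (r (n + e\<^sub>1)) (r (n + e\<^sub>2 + e\<^sub>1)) (1, t n) (1, s n) = ?\<omega> n" for n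
    unfolding vertex_def quadric_patch shift_commute by (rule refl, rule patch_swap)
  have hom: "all_if_any (\<lambda>n. \<exists>L. shared_generator r p n e\<^sub>1 L \<and> ?\<omega> n \<in> L)"
      "all_if_any (\<lambda>n. \<exists>L. shared_generator r p n e\<^sub>2 L \<and> ?\<omega> n \<in> L)"
    using assms(3) unfolding homogeneous_def by blast+
  have nsh: "\<not> shared_generator r p n e\<^sub>1 (span {?\<omega> n, ?\<omega> (n + e\<^sub>1)})"
      "\<not> shared_generator r p n e\<^sub>2 (span {?\<omega> n, ?\<omega> (n + e\<^sub>2)})" for n
    using assms(4) unfolding edge_def by blast+
  have swap: "tangent_plane r p n (1, s n) (1, t n) =
      patch_tangent (p n) (r n) (r (n + e\<^sub>2)) (r (n + e\<^sub>1)) (r (n + e\<^sub>2 + e\<^sub>1)) (1, t n) (1, s n)" for n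
    unfolding tangent_plane_patch shift_commute by (rule patch_tangent_swap)
  have "(\<forall>n. D1 c p n = 0) \<longleftrightarrow> (\<exists>l \<in> associated_congruences r ?\<omega>. intersection_property l e\<^sub>1)"
    unfolding D1_def associated_congruences_def
    using disc_zero_iff_intersection[of r e\<^sub>1 e\<^sub>2 "\<alpha>0 c" "\<alpha>1 c" "\<alpha>3 c" "\<beta>1 c" "\<beta>2 c" "\<beta>3 c" p s t, unfolded v1,
      OF neighbours_1[OF net] C1_parameter_1[OF net] st tp(1)[unfolded tangent_plane_patch]
        tp(3)[unfolded tangent_plane_patch] ne(1) hom(1)[unfolded shared_generator_patch_1] nsh(1)[unfolded shared_generator_patch_1]] .
  moreover have "(\<forall>n. D2 c p n = 0) \<longleftrightarrow> (\<exists>l \<in> associated_congruences r ?\<omega>. intersection_property l e\<^sub>2)"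
  proof -
    have "(\<forall>n. D2 c p n = 0) \<longleftrightarrow>
      (\<forall>n. (\<gamma>0 c n * \<delta>3 c n - \<gamma>2 c n * \<delta>1 c n * p n)\<^sup>2 + 4 * \<gamma>0 c n * \<gamma>3 c n * \<delta>2 c n * \<delta>1 c n * p n = 0)"
      by (simp add: D2_def mult_ac)
    also have "\<dots> \<longleftrightarrow> (\<exists>l \<in> {\<lambda>n. span {r n, ?\<omega> n}, \<lambda>n. span {r (n + e\<^sub>2), ?\<omega> n},
      \<lambda>n. span {r (n + e\<^sub>1), ?\<omega> n}, \<lambda>n. span {r (n + e\<^sub>2 + e\<^sub>1), ?\<omega> n}}. intersection_property l e\<^sub>2)"
      using disc_zero_iff_intersection[of r e\<^sub>2 e\<^sub>1 "\<gamma>0 c" "\<gamma>2 c" "\<gamma>3 c" "\<delta>2 c" "\<delta>1 c" "\<delta>3 c" p t s, unfolded v2,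
        OF neighbours_2[OF net] C1_parameter_2[OF net] st(2,1) tp(2)[unfolded swap]
          tp(4)[unfolded swap] ne(2) hom(2)[unfolded shared_generator_patch_2] nsh(2)[unfolded shared_generator_patch_2]] .
    also have "\<dots> \<longleftrightarrow> (\<exists>l \<in> associated_congruences r ?\<omega>. intersection_property l e\<^sub>2)"
      unfolding associated_congruences_def shift_commute by blast
    finally show ?thesis .
  qed
  ultimately show ?thesis
    using net unfolding discrete_godeaux_rozet_def by blast
qed

end
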